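(* $\mathsf{L/quasipoly} \supseteq \mathsf{NL/poly}$.
   Context: $\mathsf{L/poly}$ (resp. $\mathsf{NL/poly}$) is the class of decision problems solvable by a deterministic (resp. nondeterministic) $O(\log n)$-space Turing machine with advice of size polynomial in the input length $n$. $\mathsf{L/quasipoly}$ is the class of decision problems solvable by a deterministic $O(\log n)$-space Turing machine with advice of quasipolynomial size, i.e. size $2^{(\log n)^{O(1)}}$. *)

theory Defs
  imports Complex_Main "HOL-Library.Landau_Symbols"
begin

text \<open>
  Machines have a two-way read-only input tape, a two-way read-only advice tape and one read-write
  work tape. Only the work tape is charged for space; in particular a head position on
  the advice tape is free, so that advice longer than polynomial can be read in logarithmic space.
\<close>

datatype cell = Left_End | Bit bool | Right_End

datatype direction = Lft | Stay | Rgt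

text \<open>
  States are the numbers below \<open>num_states\<close>, work-tape symbols the numbers below
  \<open>num_symbols\<close>, with 0 as the blank. The transition function maps a state and the
  scanned input, advice and work symbols to the set of admissible combinations of next state,
  written work symbol, and directions of the input, advice and work head.
\<close>

record machine =
  num_states :: nat
  num_symbols :: nat
  start_state :: nat
  accept_state :: nat
  reject_state :: nat
  delta :: "nat \<Rightarrow> cell \<Rightarrow> cell \<Rightarrow> nat
              \<Rightarrow> (nat \<times> nat \<times> direction \<times> direction \<times> direction) set"

definition nondeterministic_TM :: "machine \<Rightarrow> bool" where
  "nondeterministic_TM M \<longleftrightarrow>
     0 < num_symbols M \<and>
     start_state M < num_states M \<and> accept_state M < num_states M \<and>
     reject_state M < num_states M \<and> accept_state M \<noteq> reject_state M \<and>
     (\<forall>q < num_states M. \<forall>u v. \<forall>s < num_symbols M.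
        delta M q u v s \<subseteq> {..<num_states M} \<times> {..<num_symbols M} \<times> UNIV)"

definition deterministic_TM :: "machine \<Rightarrow> bool" where
  "deterministic_TM M \<longleftrightarrow>
     nondeterministic_TM M \<and>
     (\<forall>q < num_states M. \<forall>u v. \<forall>s < num_symbols M. is_singleton (delta M q u v s))"

record config =
  state :: nat
  input_pos :: nat
  advice_pos :: nat
  work_tape :: "nat \<Rightarrow> nat"
  work_pos :: nat

text \<open>A word \<open>w\<close> occupies cells 1 to \<open>length w\<close>, between the two end markers.\<close>

definition read_cell :: "bool list \<Rightarrow> nat \<Rightarrow> cell" where
  "read_cell w i =
     (if i = 0 then Left_End else if i \<le> length w then Bit (w ! (i - 1)) else Right_End)"

fun move :: "direction \<Rightarrow> nat \<Rightarrow> nat" where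
  "move Lft i = i - 1"
| "move Stay i = i"
| "move Rgt i = Suc i"

definition move_within :: "bool list \<Rightarrow> direction \<Rightarrow> nat \<Rightarrow> nat" where
  "move_within w d i = min (length w + 1) (move d i)"

definition initial :: "machine \<Rightarrow> config" where
  "initial M = \<lparr>state = start_state M, input_pos = 0, advice_pos = 0,
                work_tape = (\<lambda>_. 0), work_pos = 0\<rparr>"

inductive step :: "machine \<Rightarrow> bool list \<Rightarrow> bool list \<Rightarrow> config \<Rightarrow> config \<Rightarrow> bool"
  for M :: machine and x y :: "bool list" where
  "state c \<noteq> accept_state M \<Longrightarrow> state c \<noteq> reject_state M \<Longrightarrow>
   (q, s, d1, d2, d3) \<in> delta M (state c) (read_cell x (input_pos c))
                           (read_cell y (advice_pos c)) (work_tape c (work_pos c)) \<Longrightarrow>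
   step M x y c
     \<lparr>state = q,
      input_pos = move_within x d1 (input_pos c),
      advice_pos = move_within y d2 (advice_pos c),
      work_tape = (work_tape c)(work_pos c := s),
      work_pos = move d3 (work_pos c)\<rparr>"

definition reachable :: "machine \<Rightarrow> bool list \<Rightarrow> bool list \<Rightarrow> config \<Rightarrow> bool" where
  "reachable M x y c \<longleftrightarrow> (step M x y)\<^sup>*\<^sup>* (initial M) c"

definition accepts :: "machine \<Rightarrow> bool list \<Rightarrow> bool list \<Rightarrow> bool" where
  "accepts M x y \<longleftrightarrow> (\<exists>c. reachable M x y c \<and> state c = accept_state M)"

definition rejects :: "machine \<Rightarrow> bool list \<Rightarrow> bool list \<Rightarrow> bool" where
  "rejects M x y \<longleftrightarrow> (\<exists>c. reachable M x y c \<and> state c = reject_state M)"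

definition uses_space_at_most :: "machine \<Rightarrow> bool list \<Rightarrow> bool list \<Rightarrow> nat \<Rightarrow> bool" where
  "uses_space_at_most M x y b \<longleftrightarrow> (\<forall>c. reachable M x y c \<longrightarrow> work_pos c < b)"

text \<open>
  The space bound holds on every computation path, on every input together with the
  advice for its length.
\<close>

definition logspace_with_advice :: "machine \<Rightarrow> (nat \<Rightarrow> bool list) \<Rightarrow> bool" where
  "logspace_with_advice M a \<longleftrightarrow>
     (\<exists>b :: nat \<Rightarrow> nat. (\<lambda>n. real (b n)) \<in> O(\<lambda>n. ln (real n)) \<and>
        (\<forall>x. uses_space_at_most M x (a (length x)) (b (length x))))"

text \<open>Decision problems are languages over the binary alphabet.\<close>

type_synonym language = "bool list set"

text \<open>
  A deterministic machine has to halt on every input. A nondeterministic one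
  solves a problem if precisely the yes-instances have an accepting computation; its other
  computations may be infinite.
\<close>

definition L_with_advice :: "(nat \<Rightarrow> nat) set \<Rightarrow> language set" where
  "L_with_advice F =
     {A. \<exists>M a. deterministic_TM M \<and> (\<lambda>n. length (a n)) \<in> F \<and> logspace_with_advice M a \<and>
           (\<forall>x. (x \<in> A \<longrightarrow> accepts M x (a (length x))) \<and>
                (x \<notin> A \<longrightarrow> rejects M x (a (length x))))}"

definition NL_with_advice :: "(nat \<Rightarrow> nat) set \<Rightarrow> language set" where
  "NL_with_advice F =
     {A. \<exists>M a. nondeterministic_TM M \<and> (\<lambda>n. length (a n)) \<in> F \<and> logspace_with_advice M a \<and>
           (\<forall>x. x \<in> A \<longleftrightarrow> accepts M x (a (length x)))}"

definition polynomial_size :: "(nat \<Rightarrow> nat) set" where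
  "polynomial_size = {f. \<exists>k :: nat. (\<lambda>n. real (f n)) \<in> O(\<lambda>n. real n ^ k)}"

definition quasipolynomial_size :: "(nat \<Rightarrow> nat) set" where
  "quasipolynomial_size =
     {f. \<exists>k :: nat. \<forall>\<^sub>F n in sequentially. real (f n) \<le> 2 powr (log 2 (real n) ^ k)}"

definition NL_poly :: "language set" where
  "NL_poly = NL_with_advice polynomial_size"

definition L_quasipoly :: "language set" where
  "L_quasipoly = L_with_advice quasipolynomial_size"

end

theory Submission
  imports Defs "HOL-Library.Countable_Set" "HOL-Real_Asymp.Real_Asymp"
begin

text \<open>
  By Savitch's recursion, reachability in the polynomially large configuration graph of a
  nondeterministic machine is an and-or formula of logarithmic depth and quasipolynomial
  size, each leaf of which (is there a transition between two given configurations?) depends on a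
  single input cell. The formula is written on the advice tape and evaluated in a single pass from
  left to right with short-circuiting: once the value of a subformula is determined, its remaining
  part is skipped by counting brackets. The bracket counter is bounded by the depth of the formula, so
  it can be kept in unary as the position of the work head. Positions on the advice tape are never
  stored, and leaves address their input cell by moves of the input head written out in the
  advice, so nothing else needs space.
\<close>

section \<open>Short-circuit programs\<close>

datatype token = Go direction | Test "cell set" | Open | Close | Break bool

text \<open>
  In a state \<open>(v, p, m)\<close>, \<open>v\<close> is the last truth value computed, \<open>p\<close> the
  position of the input head, and \<open>m\<close> the number of blocks whose closing token is still to be
  skipped; tokens take effect only if \<open>m = 0\<close>.
\<close>

fun exec :: "bool list \<Rightarrow> token \<Rightarrow> bool \<times> nat \<times> nat \<Rightarrow> bool \<times> nat \<times> nat" where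
  "exec x (Go d) (v, p, m) = (v, if m = 0 then move_within x d p else p, m)"
| "exec x (Test S) (v, p, m) = (if m = 0 then read_cell x p \<in> S else v, p, m)"
| "exec x Open (v, p, m) = (v, p, if m = 0 then 0 else Suc m)"
| "exec x Close (v, p, m) = (v, p, m - 1)"
| "exec x (Break b) (v, p, m) = (v, p, if m = 0 \<and> v = b then 1 else m)"

text \<open>\<open>D\<close> bounds the skip counter in every intermediate state, including both
  ends; the counter will be the position of the work head, so \<open>D\<close> becomes the space
  bound.\<close>

fun run :: "bool list \<Rightarrow> nat \<Rightarrow> bool \<times> nat \<times> nat \<Rightarrow> token list \<Rightarrow> bool \<times> nat \<times> nat \<Rightarrow> bool"
  where
  "run x D s [] s' \<longleftrightarrow> s' = s \<and> snd (snd s) \<le> D"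
| "run x D s (t # ts) s' \<longleftrightarrow> snd (snd s) \<le> D \<and> run x D (exec x t s) ts s'"

lemma run_append:
  "run x D s ts s' \<Longrightarrow> run x D s' us s'' \<Longrightarrow> run x D s (ts @ us) s''"
  by (induction ts arbitrary: s) auto

text \<open>\<open>Conn True\<close> is disjunction and \<open>Conn False\<close> conjunction. In
  both cases \<open>b\<close> is the absorbing value, so one token \<open>Break b\<close>
  short-circuits either connective.\<close>

datatype form = Leaf nat "cell set" | Conn bool "form list"

primrec val :: "bool list \<Rightarrow> form \<Rightarrow> bool" where
  "val x (Leaf i S) \<longleftrightarrow> read_cell x i \<in> S"
| "val x (Conn b fs) \<longleftrightarrow> (b \<longleftrightarrow> b \<in> set (map (val x) fs))"

text \<open>A leaf walks to its cell and back, so every subprogram starts and ends with the input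
  head at 0. \<open>Test {u. \<not> b}\<close> ignores the scanned cell, its set being full or
  empty: it loads the neutral value \<open>\<not> b\<close>, the result if no \<open>Break b\<close>
  fires.\<close>

primrec compile :: "form \<Rightarrow> token list" where
  "compile (Leaf i S) = replicate i (Go Rgt) @ Test S # replicate i (Go Lft)"
| "compile (Conn b fs) =
     Open # Test {u. \<not> b} # concat (map (\<lambda>ts. ts @ [Break b]) (map compile fs)) @ [Close]"

text \<open>The bracket depth of the compiled program; the added 0 gives \<open>Max\<close> a value
  when \<open>fs\<close> is empty.\<close>

primrec height :: "form \<Rightarrow> nat" where
  "height (Leaf i S) = 0"
| "height (Conn b fs) = Suc (Max (set (0 # map height fs)))"

primrec leaves_within :: "nat \<Rightarrow> form \<Rightarrow> bool" where
  "leaves_within n (Leaf i S) \<longleftrightarrow> i \<le> n"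
| "leaves_within n (Conn b fs) \<longleftrightarrow> list_all id (map (leaves_within n) fs)"

lemma height_Conn: "height (Conn b fs) = Suc (Max (insert 0 (height ` set fs)))"
  by simp

lemma height_less_Conn: "f \<in> set fs \<Longrightarrow> height f < height (Conn b fs)"
  unfolding height_Conn by (simp add: less_Suc_eq_le)

lemma height_Conn_leI: "(\<And>f. f \<in> set fs \<Longrightarrow> height f < h) \<Longrightarrow> 0 < h \<Longrightarrow> height (Conn b fs) \<le> h"
  unfolding height_Conn by (simp add: Suc_le_eq)

text \<open>With a positive counter only \<open>Open\<close> and \<open>Close\<close> act. Compiled
  formulas are balanced, so the counter never falls below its initial value, rises by at most the
  bracket depth and returns.\<close>

lemma run_skip:
  "0 < m \<Longrightarrow> m + height f \<le> D \<Longrightarrow> run x D (v, p, m) (compile f) (v, p, m)"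
proof (induction f arbitrary: m)
  case (Leaf i S)
  have skip: "run x D (v, p, m) (replicate i (Go d)) (v, p, m)" for d
    using Leaf by (induction i) auto
  show ?case
    using Leaf run_append[OF skip, of "Test S # replicate i (Go Lft)" "(v, p, m)"] skip by auto
next
  case (Conn b fs)
  have "run x D (v, p, Suc m) (concat (map (\<lambda>ts. ts @ [Break b]) (map compile gs))) (v, p, Suc m)"
    if "set gs \<subseteq> set fs" for gs
    using that
  proof (induction gs)
    case Nil
    then show ?case using Conn.prems by simp
  next
    case (Cons g gs)
    then have "height g < height (Conn b fs)"
      by (intro height_less_Conn) auto
    then have "run x D (v, p, Suc m) (compile g) (v, p, Suc m)"
      using Cons.prems Conn.prems by (intro Conn.IH) auto
    then show ?case
      using Cons Conn.prems by (auto intro!: run_append)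
  qed
  from run_append[OF this[of fs], of "[Close]" "(v, p, m)"] show ?case
    using Conn.prems by (auto simp del: height.simps simp: height_Conn)
qed

lemma run_Go_Rgt:
  "p + i \<le> Suc (length x) \<Longrightarrow> run x D (v, p, 0) (replicate i (Go Rgt)) (v, p + i, 0)"
proof (induction i arbitrary: p)
  case (Suc i)
  then show ?case using Suc.IH[of "Suc p"] by (simp add: move_within_def)
qed simp

lemma run_Go_Lft:
  "p + i \<le> Suc (length x) \<Longrightarrow> run x D (v, p + i, 0) (replicate i (Go Lft)) (v, p, 0)"
  by (induction i) (auto simp: move_within_def)

text \<open>The initial \<open>v\<close> is arbitrary because each subprogram overwrites it before
  \<open>Break\<close> looks at it. The counter leaves 0 only after a break, and then the remaining
  subformulas have smaller height, which pays for the extra 1.\<close>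

lemma run_compile:
  "leaves_within (Suc (length x)) f \<Longrightarrow> height f \<le> D \<Longrightarrow>
     run x D (v, 0, 0) (compile f) (val x f, 0, 0)"
proof (induction f arbitrary: v)
  case (Leaf i S)
  then show ?case
    using run_Go_Rgt[of 0 i x D v] run_Go_Lft[of 0 i x D "read_cell x i \<in> S"]
    by (auto intro!: run_append)
next
  case (Conn b fs)
  let ?block = "\<lambda>gs. concat (map (\<lambda>ts. ts @ [Break b]) (map compile gs))"
  have D: "0 < D"
    using Conn.prems by (simp add: height_Conn)
  have g: "height g < D" "leaves_within (Suc (length x)) g" if "g \<in> set fs" for g
    using that Conn.prems height_less_Conn[OF that, of b] by (auto simp: list_all_iff)
  have skip: "run x D (b, 0, 1) (?block gs) (b, 0, 1)" if "set gs \<subseteq> set fs" for gs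
    using that
  proof (induction gs)
    case Nil
    then show ?case using D by simp
  next
    case (Cons h gs)
    then have "run x D (b, 0, 1) (compile h) (b, 0, 1)"
      using g[of h] by (intro run_skip) auto
    then show ?case
      using Cons D by (auto intro!: run_append)
  qed
  \<comment> \<open>\<open>m\<close> is 1 if a break fired and 0 otherwise; by truncated subtraction
    the final \<open>Close\<close> turns both into 0.\<close>
  have "\<exists>m. run x D (\<not> b, 0, 0) (?block gs) (val x (Conn b gs), 0, m) \<and> m \<le> 1"
    if "set gs \<subseteq> set fs" for gs
    using that
  proof (induction gs)
    case Nil
    then show ?case by (intro exI[of _ 0]) auto
  next
    case (Cons h gs)
    have h: "run x D (\<not> b, 0, 0) (compile h) (val x h, 0, 0)"
      using Cons.prems g[of h] Conn.prems by (intro Conn.IH) auto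
    show ?case
    proof (cases "val x h = b")
      case True
      then have "run x D (\<not> b, 0, 0) (?block (h # gs)) (b, 0, 1)"
        using h skip[of gs] Cons.prems D by (auto intro!: run_append)
      then show ?thesis
        using True by (intro exI[of _ 1]) auto
    next
      case False
      then have v: "val x h = (\<not> b)" by auto
      from Cons obtain m where
        "run x D (\<not> b, 0, 0) (?block gs) (val x (Conn b gs), 0, m)" "m \<le> 1" by auto
      then have r: "run x D (\<not> b, 0, 0) (?block (h # gs)) (val x (Conn b gs), 0, m)"
        using h D unfolding v by (auto intro!: run_append)
      have e: "val x (Conn b (h # gs)) = val x (Conn b gs)"
        using v by auto
      from r \<open>m \<le> 1\<close> show ?thesis unfolding e by blast
    qed
  qed
  then obtain m where m: "run x D (\<not> b, 0, 0) (?block fs) (val x (Conn b fs), 0, m)" "m \<le> 1"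
    by blast
  have "m \<le> D" using m D by simp
  then have "run x D (\<not> b, 0, 0) (?block fs @ [Close]) (val x (Conn b fs), 0, 0)"
    using m by (intro run_append[OF m(1)]) auto
  moreover have "exec x Open (v, 0, 0) = (v, 0, 0)" "exec x (Test {u. \<not> b}) (v, 0, 0) = (\<not> b, 0, 0)"
    by simp_all
  ultimately show ?case
    by (simp only: compile.simps append_Cons run.simps snd_conv le0 simp_thms)
qed

section \<open>A machine interpreting programs\<close>

lemma finite_cells: "finite (UNIV :: cell set)"
proof -
  have "UNIV = {Left_End, Bit True, Bit False, Right_End}"
    by (auto intro: cell.exhaust)
  then show ?thesis by (metis finite.simps)
qed

text \<open>Input positions are spelled out by \<open>Go\<close> moves, and \<open>Test\<close>
  carries a subset of the four cell contents. Hence one fixed machine can interpret programs for all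
  input lengths.\<close>

lemma finite_tokens: "finite (UNIV :: token set)"
proof -
  have "finite (UNIV :: direction set)"
  proof -
    have "UNIV = {Lft, Stay, Rgt}" by (auto intro: direction.exhaust)
    then show ?thesis by (metis finite.simps)
  qed
  moreover have "finite (UNIV :: cell set set)"
    using finite_cells by (simp add: Finite_Set.finite_set)
  ultimately have "finite (range Go \<union> range Test \<union> {Open, Close} \<union> range Break)"
    by simp
  moreover have "t \<in> range Go \<union> range Test \<union> {Open, Close} \<union> range Break" for t
    by (cases t) auto
  ultimately show ?thesis
    by (meson finite_subset subsetI)
qed

definition token_count :: nat where
  "token_count = card (UNIV :: token set)"

text \<open>Unary with a terminator: decoding needs only a bounded counter in the finite control,
  and a token costs a constant number of advice bits.\<close>

definition token_code :: "token \<Rightarrow> bool list" where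
  "token_code t = replicate (to_nat_on UNIV t) True @ [False]"

lemma token_no_less: "to_nat_on UNIV (t :: token) < token_count"
  using to_nat_on_finite[OF finite_tokens] unfolding token_count_def bij_betw_def by blast

lemma length_token_code: "length (token_code t) \<le> token_count"
  using token_no_less[of t] by (simp add: token_code_def)

lemma length_concat_token_code:
  "length (concat (map token_code ts)) \<le> token_count * length ts"
  using length_token_code by (induction ts) (auto intro: add_mono)

text \<open>In \<open>Ctrl v t\<close>, \<open>v\<close> is the current truth value and
  \<open>t\<close> the number of \<open>True\<close> bits read so far in the current token
  code.\<close>

datatype ctrl = Ctrl bool nat | Halt bool

text \<open>\<open>token_count\<close> exceeds every code and serves as the value at which the
  counter saturates, so the state set is closed under transitions on arbitrary advice.\<close>

definition ctrls :: "ctrl set" where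
  "ctrls = case_prod Ctrl ` (UNIV \<times> {..token_count}) \<union> range Halt"

lemma finite_ctrls: "finite ctrls"
  by (auto simp: ctrls_def)

lemma Ctrl_in_ctrls [simp]: "Ctrl v t \<in> ctrls \<longleftrightarrow> t \<le> token_count"
  by (auto simp: ctrls_def)

lemma Halt_in_ctrls [simp]: "Halt b \<in> ctrls"
  by (auto simp: ctrls_def)

abbreviation ctrl_no :: "ctrl \<Rightarrow> nat" where
  "ctrl_no \<equiv> to_nat_on ctrls"

lemma ctrl_no_less: "q \<in> ctrls \<Longrightarrow> ctrl_no q < card ctrls"
  using to_nat_on_finite[OF finite_ctrls] unfolding bij_betw_def by blast

lemma ctrl_no_eq_iff: "q \<in> ctrls \<Longrightarrow> r \<in> ctrls \<Longrightarrow> ctrl_no q = ctrl_no r \<longleftrightarrow> q = r"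
  using to_nat_on_finite[OF finite_ctrls] unfolding bij_betw_def inj_on_def by blast

lemma from_nat_into_ctrls: "from_nat_into ctrls i \<in> ctrls"
  by (rule from_nat_into) (auto simp: ctrls_def)

text \<open>
  Cell 0 of the work tape carries the symbol 1, so the machine sees whether the work head, whose
  position is the number of blocks to be skipped, is at 0.
\<close>

fun trans :: "ctrl \<Rightarrow> cell \<Rightarrow> cell \<Rightarrow> nat
    \<Rightarrow> ctrl \<times> nat \<times> direction \<times> direction \<times> direction" where
  "trans (Halt b) u a s = (Halt b, s, Stay, Stay, Stay)"
| "trans (Ctrl v t) u Left_End s = (Ctrl v t, 1, Stay, Rgt, Stay)"
| "trans (Ctrl v t) u Right_End s = (Halt v, s, Stay, Stay, Stay)"
| "trans (Ctrl v t) u (Bit True) s = (Ctrl v (min token_count (Suc t)), s, Stay, Rgt, Stay)"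
| "trans (Ctrl v t) u (Bit False) s =
     (case from_nat_into UNIV t of
        Go d \<Rightarrow> (Ctrl v 0, s, if s = 1 then d else Stay, Rgt, Stay)
      | Test S \<Rightarrow> (Ctrl (if s = 1 then u \<in> S else v) 0, s, Stay, Rgt, Stay)
      | Open \<Rightarrow> (Ctrl v 0, s, Stay, Rgt, if s = 1 then Stay else Rgt)
      | Close \<Rightarrow> (Ctrl v 0, s, Stay, Rgt, Lft)
      | Break b \<Rightarrow> (Ctrl v 0, s, Stay, Rgt, if s = 1 \<and> v = b then Rgt else Stay))"

definition interpreter :: machine where
  "interpreter =
     \<lparr>num_states = card ctrls, num_symbols = 2, start_state = ctrl_no (Ctrl False 0),
      accept_state = ctrl_no (Halt True), reject_state = ctrl_no (Halt False),
      delta = (\<lambda>q u a s. {apfst ctrl_no (trans (from_nat_into ctrls q) u a s)})\<rparr>"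

lemma trans_closed:
  "q \<in> ctrls \<Longrightarrow> s < 2 \<Longrightarrow> trans q u a s \<in> ctrls \<times> {..<2} \<times> UNIV"
  by (induction q u a s rule: trans.induct) (auto split: token.split)

lemma deterministic_interpreter: "deterministic_TM interpreter"
proof -
  have "apfst ctrl_no (trans (from_nat_into ctrls q) u a s) \<in> {..<card ctrls} \<times> {..<2} \<times> UNIV"
    if "s < 2" for q u a s
    using trans_closed[OF from_nat_into_ctrls[of q] that, of u a]
    by (cases "trans (from_nat_into ctrls q) u a s") (auto intro: ctrl_no_less)
  then show ?thesis
    unfolding deterministic_TM_def nondeterministic_TM_def interpreter_def
    by (auto simp: ctrl_no_less ctrl_no_eq_iff)
qed

section \<open>Runs of the interpreter and their space\<close>

lemma step_interpreter:
  assumes "t \<le> token_count"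
    and "trans (Ctrl v t) (read_cell x p) (read_cell y i) (w m) = (q, s, d1, d2, d3)"
  shows "step interpreter x y
           \<lparr>state = ctrl_no (Ctrl v t), input_pos = p, advice_pos = i, work_tape = w,
            work_pos = m\<rparr> c \<longleftrightarrow>
         c = \<lparr>state = ctrl_no q, input_pos = move_within x d1 p,
              advice_pos = move_within y d2 i, work_tape = w(m := s), work_pos = move d3 m\<rparr>"
  using assms
  by (auto simp: step.simps interpreter_def ctrl_no_eq_iff finite_ctrls countable_finite)

text \<open>Reachability and the space bound in one transitive relation: whatever can be reached
  from \<open>c\<close> is within the bound or lies beyond \<open>c'\<close>, so consecutive
  segments can be treated separately.\<close>

definition leads_to :: "machine \<Rightarrow> bool list \<Rightarrow> bool list \<Rightarrow> nat \<Rightarrow> config \<Rightarrow> config \<Rightarrow> bool" where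
  "leads_to M x y D c c' \<longleftrightarrow>
     (step M x y)\<^sup>*\<^sup>* c c' \<and>
     (\<forall>e. (step M x y)\<^sup>*\<^sup>* c e \<longrightarrow> work_pos e \<le> D \<or> (step M x y)\<^sup>*\<^sup>* c' e)"

lemma leads_to_refl: "leads_to M x y D c c"
  by (simp add: leads_to_def)

lemma leads_to_trans:
  "leads_to M x y D c c' \<Longrightarrow> leads_to M x y D c' c'' \<Longrightarrow> leads_to M x y D c c''"
  unfolding leads_to_def by (meson rtranclp_trans)

lemma leads_to_step:
  assumes "\<And>e. step M x y c e \<longleftrightarrow> e = c'" and "work_pos c \<le> D"
  shows "leads_to M x y D c c'"
  using assms unfolding leads_to_def by (metis converse_rtranclpE r_into_rtranclp)

text \<open>The tape holds nothing but the marker in cell 0; the skip counter \<open>m\<close>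
  exists only as the position of the work head.\<close>

fun conf :: "bool \<times> nat \<times> nat \<Rightarrow> nat \<Rightarrow> nat \<Rightarrow> config" where
  "conf (v, p, m) t i =
     \<lparr>state = ctrl_no (Ctrl v t), input_pos = p, advice_pos = i,
      work_tape = (\<lambda>_. 0)(0 := 1), work_pos = m\<rparr>"

lemma work_tape_idem: "((\<lambda>_. 0)(0 := 1))(m := if m = 0 then 1 else 0) = (\<lambda>_. 0 :: nat)(0 := 1)"
  by auto

lemma leads_to_conf:
  assumes "trans (Ctrl v t) (read_cell x p) (read_cell y i) (if m = 0 then 1 else 0) =
             (Ctrl v' t', if m = 0 then 1 else 0, di, da, dw)"
    and "t \<le> token_count" "m \<le> D"
    and "p' = move_within x di p" "i' = move_within y da i" "m' = move dw m"
  shows "leads_to interpreter x y D (conf (v, p, m) t i) (conf (v', p', m') t' i')"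
  unfolding conf.simps
proof (rule leads_to_step)
  have tape: "((\<lambda>_. 0 :: nat)(0 := 1)) m = (if m = 0 then 1 else 0)" by simp
  show "step interpreter x y
      \<lparr>state = ctrl_no (Ctrl v t), input_pos = p, advice_pos = i, work_tape = (\<lambda>_. 0)(0 := 1),
       work_pos = m\<rparr> e \<longleftrightarrow>
    e = \<lparr>state = ctrl_no (Ctrl v' t'), input_pos = p', advice_pos = i',
         work_tape = (\<lambda>_. 0)(0 := 1), work_pos = m'\<rparr>" for e
    by (subst step_interpreter[OF assms(2), of v x p y i "(\<lambda>_. 0)(0 := 1)" m,
          unfolded tape, OF assms(1)])
      (simp only: work_tape_idem assms(4-6))
qed (use assms in simp)

text \<open>The assumption \<open>k < token_count\<close> keeps the saturating counter exact.
  Positions carry a \<open>Suc\<close> because words start at cell 1.\<close>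

lemma leads_to_count:
  assumes "y = ws @ replicate k True @ zs" "j \<le> k" "k < token_count"
    and "p \<le> Suc (length x)" "m \<le> D"
  shows "leads_to interpreter x y D (conf (v, p, m) 0 (Suc (length ws)))
           (conf (v, p, m) j (Suc (length ws + j)))"
  using assms(2)
proof (induction j)
  case 0
  then show ?case by (simp add: leads_to_refl)
next
  case (Suc j)
  have "read_cell y (Suc (length ws + j)) = Bit True"
    using Suc.prems assms(1) by (auto simp: read_cell_def nth_append)
  then have "leads_to interpreter x y D (conf (v, p, m) j (Suc (length ws + j)))
      (conf (v, p, m) (Suc j) (Suc (length ws + Suc j)))"
    using Suc.prems assms
    by (intro leads_to_conf[where di = Stay and da = Rgt and dw = Stay])
      (auto simp: move_within_def)
  then show ?case
    using Suc by (auto intro: leads_to_trans)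
qed

lemma leads_to_token:
  assumes "y = ws @ token_code k @ zs" "p \<le> Suc (length x)" "m \<le> D"
  shows "leads_to interpreter x y D (conf (v, p, m) 0 (Suc (length ws)))
           (conf (exec x k (v, p, m)) 0 (Suc (length (ws @ token_code k))))"
proof -
  let ?k = "to_nat_on UNIV k" and ?i = "Suc (length ws + to_nat_on UNIV k)"
  have k: "from_nat_into UNIV ?k = k"
    using finite_tokens by (simp add: countable_finite)
  have le: "?k \<le> token_count"
    using token_no_less[of k] by simp
  have pre:
    "leads_to interpreter x y D (conf (v, p, m) 0 (Suc (length ws))) (conf (v, p, m) ?k ?i)"
    using assms token_no_less[of k]
    by (intro leads_to_count[of _ _ _ "False # zs"]) (auto simp: token_code_def)
  have cell: "read_cell y ?i = Bit False"
    using assms(1) by (auto simp: read_cell_def nth_append token_code_def)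
  have i: "Suc (length (ws @ token_code k)) = move_within y Rgt ?i"
    using assms(1) by (auto simp: move_within_def token_code_def)
  \<comment> \<open>\<open>move_within\<close> clamps even when the head stays, hence the bound on
    \<open>p\<close>.\<close>
  have p: "p = move_within x Stay p"
    using assms(2) by (simp add: move_within_def)
  obtain v' p' m' where e: "exec x k (v, p, m) = (v', p', m')"
    by (metis prod_cases3)
  \<comment> \<open>The marker reveals whether \<open>m = 0\<close>, and \<open>exec\<close> only
    keeps, increments or decrements \<open>m\<close>, so one move of the work head at the
    terminating \<open>False\<close> carries out the whole token.\<close>
  have "\<exists>di dw. trans (Ctrl v ?k) (read_cell x p) (Bit False) (if m = 0 then 1 else 0) =
            (Ctrl v' 0, if m = 0 then 1 else 0, di, Rgt, dw) \<and>
          p' = move_within x di p \<and> m' = move dw m"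
  proof (cases k)
    case (Go d)
    then show ?thesis
      using e k p by (intro exI[of _ "if m = 0 then d else Stay"] exI[of _ Stay]) auto
  next
    case (Test S)
    then show ?thesis
      using e k p by (intro exI[of _ Stay]) auto
  next
    case Open
    then show ?thesis
      using e k p by (intro exI[of _ Stay] exI[of _ "if m = 0 then Stay else Rgt"]) auto
  next
    case Close
    then show ?thesis
      using e k p by (intro exI[of _ Stay] exI[of _ Lft]) auto
  next
    case (Break b)
    then show ?thesis
      using e k p
      by (intro exI[of _ Stay] exI[of _ "if m = 0 \<and> v = b then Rgt else Stay"]) auto
  qed
  then have "leads_to interpreter x y D (conf (v, p, m) ?k ?i)
      (conf (exec x k (v, p, m)) 0 (Suc (length (ws @ token_code k))))"
    using leads_to_conf[OF _ le assms(3) _ i] unfolding e cell by blast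
  with pre show ?thesis by (rule leads_to_trans)
qed

lemma exec_input_pos:
  "fst (snd s) \<le> Suc (length x) \<Longrightarrow> fst (snd (exec x k s)) \<le> Suc (length x)"
  by (cases "(x, k, s)" rule: exec.cases) (auto simp: move_within_def)

lemma leads_to_run:
  assumes "run x D s ts s'" "fst (snd s) \<le> Suc (length x)"
    and "y = ws @ concat (map token_code ts)"
  shows "leads_to interpreter x y D (conf s 0 (Suc (length ws))) (conf s' 0 (Suc (length y)))"
  using assms
proof (induction ts arbitrary: s ws)
  case Nil
  then show ?case by (simp add: leads_to_refl)
next
  case (Cons k ts)
  obtain v p m where s: "s = (v, p, m)" by (metis prod_cases3)
  have "leads_to interpreter x y D (conf s 0 (Suc (length ws)))
           (conf (exec x k s) 0 (Suc (length (ws @ token_code k))))"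
    using Cons.prems unfolding s by (intro leads_to_token) auto
  moreover have "leads_to interpreter x y D (conf (exec x k s) 0 (Suc (length (ws @ token_code k))))
      (conf s' 0 (Suc (length y)))"
    using Cons.prems by (intro Cons.IH exec_input_pos) auto
  ultimately show ?case by (rule leads_to_trans)
qed

lemma interpreter_correct:
  assumes "leaves_within (Suc (length x)) f" and "y = concat (map token_code (compile f))"
  shows "val x f \<Longrightarrow> accepts interpreter x y"
    and "\<not> val x f \<Longrightarrow> rejects interpreter x y"
    and "uses_space_at_most interpreter x y (Suc (height f))"
proof -
  let ?D = "height f" and ?c = "conf (val x f, 0, 0) 0 (Suc (length y))"
  let ?h = "?c\<lparr>state := ctrl_no (Halt (val x f))\<rparr>"
  \<comment> \<open>The first step, on the left end marker of the advice, writes the marker into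
    work cell 0 and enters the program.\<close>
  have "leads_to interpreter x y ?D (initial interpreter) (conf (False, 0, 0) 0 (Suc 0))"
    by (intro leads_to_step)
      (auto simp: initial_def interpreter_def[THEN arg_cong[of _ _ start_state]]
        step_interpreter read_cell_def move_within_def)
  moreover have "leads_to interpreter x y ?D (conf (False, 0, 0) 0 (Suc 0)) ?c"
    using leads_to_run[OF run_compile[OF assms(1) order_refl], where y = y and ws = "[]"] assms(2) by simp
  moreover have "leads_to interpreter x y ?D ?c ?h"
    by (intro leads_to_step)
      (auto simp: step_interpreter read_cell_def move_within_def fun_eq_iff)
  ultimately have lead: "leads_to interpreter x y ?D (initial interpreter) ?h"
    by (blast intro: leads_to_trans)
  then have reach: "reachable interpreter x y ?h"
    by (simp add: leads_to_def reachable_def)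
  then show "val x f \<Longrightarrow> accepts interpreter x y" "\<not> val x f \<Longrightarrow> rejects interpreter x y"
    by (fastforce simp: accepts_def rejects_def interpreter_def)+
  \<comment> \<open>\<open>?h\<close> is a dead end with the work head at 0, so the configurations
    that \<open>leads_to\<close> exempts as reachable from \<open>?h\<close> obey the bound
    too.\<close>
  have "\<not> step interpreter x y ?h e" for e
    by (cases "val x f") (auto simp: step.simps interpreter_def)
  then have "e = ?h" if "(step interpreter x y)\<^sup>*\<^sup>* ?h e" for e
    using that by (metis converse_rtranclpE)
  then show "uses_space_at_most interpreter x y (Suc (height f))"
    using lead unfolding uses_space_at_most_def leads_to_def reachable_def
    by (fastforce simp: less_Suc_eq_le)
qed

section \<open>Savitch's recursion as a formula\<close>

text \<open>Is there a path of length at most \<open>2 ^ k\<close> from \<open>u\<close> to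
  \<open>v\<close>? Some midpoint \<open>w\<close> splits it into halves of length at most
  \<open>2 ^ (k - 1)\<close>. The leaves are meant to hold also for \<open>u = v\<close>, so shorter
  paths count.\<close>

primrec reach :: "'c list \<Rightarrow> ('c \<Rightarrow> 'c \<Rightarrow> form) \<Rightarrow> nat \<Rightarrow> 'c \<Rightarrow> 'c \<Rightarrow> form" where
  "reach cs leaf 0 u v = leaf u v"
| "reach cs leaf (Suc k) u v =
     Conn True (map (\<lambda>w. Conn False [reach cs leaf k u w, reach cs leaf k w v]) cs)"

text \<open>A path of length \<open>m \<le> 2 * N\<close> is cut after \<open>min m N\<close> steps.
  As \<open>R\<close> stays inside \<open>V\<close>, so does the cut point, also for the empty path
  since \<open>u \<in> V\<close>.\<close>

lemma relpow_double:
  assumes "R \<subseteq> V \<times> V" "u \<in> V"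
  shows "(\<exists>w\<in>V. (\<exists>m\<le>N. (u, w) \<in> R ^^ m) \<and> (\<exists>m\<le>N. (w, v) \<in> R ^^ m)) \<longleftrightarrow>
         (\<exists>m\<le>2 * N. (u, v) \<in> R ^^ m)"
proof
  assume "\<exists>w\<in>V. (\<exists>m\<le>N. (u, w) \<in> R ^^ m) \<and> (\<exists>m\<le>N. (w, v) \<in> R ^^ m)"
  then obtain w m m' where "m \<le> N" "m' \<le> N" "(u, w) \<in> R ^^ m" "(w, v) \<in> R ^^ m'" by blast
  then show "\<exists>m\<le>2 * N. (u, v) \<in> R ^^ m"
    by (intro exI[of _ "m + m'"]) (auto simp: relpow_add)
next
  assume "\<exists>m\<le>2 * N. (u, v) \<in> R ^^ m"
  then obtain m where m: "m \<le> 2 * N" "(u, v) \<in> R ^^ m" by blast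
  then have "(u, v) \<in> R ^^ min m N O R ^^ (m - N)"
    by (simp flip: relpow_add add: min_def)
  then obtain w where w: "(u, w) \<in> R ^^ min m N" "(w, v) \<in> R ^^ (m - N)" by blast
  have "(u, w) \<in> R\<^sup>*" using w relpow_imp_rtrancl by blast
  then have "w \<in> V" using assms by (induction rule: rtrancl_induct) auto
  moreover have "m - N \<le> N" using m by simp
  ultimately show "\<exists>w\<in>V. (\<exists>m\<le>N. (u, w) \<in> R ^^ m) \<and> (\<exists>m\<le>N. (w, v) \<in> R ^^ m)"
    using w by (meson min.cobounded2)
qed

lemma val_reach:
  assumes "\<And>u v. u \<in> set cs \<Longrightarrow> v \<in> set cs \<Longrightarrow> val x (leaf u v) \<longleftrightarrow> u = v \<or> (u, v) \<in> R"
    and "R \<subseteq> set cs \<times> set cs"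
  shows "u \<in> set cs \<Longrightarrow> v \<in> set cs \<Longrightarrow>
           val x (reach cs leaf k u v) \<longleftrightarrow> (\<exists>m\<le>2 ^ k. (u, v) \<in> R ^^ m)"
proof (induction k arbitrary: u v)
  case 0
  have "(\<exists>m\<le>1. (u, v) \<in> R ^^ m) \<longleftrightarrow> u = v \<or> (u, v) \<in> R"
    by (auto simp: le_Suc_eq)
  then show ?case using 0 assms(1) by simp
next
  case (Suc k)
  have "val x (reach cs leaf (Suc k) u v) \<longleftrightarrow>
      (\<exists>w\<in>set cs. val x (reach cs leaf k u w) \<and> val x (reach cs leaf k w v))"
    by auto
  also have "\<dots> \<longleftrightarrow> (\<exists>m\<le>2 ^ Suc k. (u, v) \<in> R ^^ m)"
    using relpow_double[OF assms(2) Suc.prems(1), of "2 ^ k" v] Suc by simp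
  finally show ?case .
qed

text \<open>Reachability in a finite relation needs at most \<open>card R\<close> steps. Bounding
  the edges by the square of the number of vertices merely doubles the recursion depth.\<close>

lemma val_reach_rtrancl:
  assumes "\<And>u v. u \<in> set cs \<Longrightarrow> v \<in> set cs \<Longrightarrow> val x (leaf u v) \<longleftrightarrow> u = v \<or> (u, v) \<in> R"
    and "R \<subseteq> set cs \<times> set cs" "(length cs)\<^sup>2 \<le> 2 ^ k" "u \<in> set cs" "v \<in> set cs"
  shows "val x (reach cs leaf k u v) \<longleftrightarrow> (u, v) \<in> R\<^sup>*"
proof -
  have fin: "finite R"
    using assms(2) by (rule finite_subset) simp
  have "card R \<le> card (set cs \<times> set cs)"
    using assms(2) by (intro card_mono) auto
  also have "\<dots> \<le> (length cs)\<^sup>2"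
    by (simp add: power2_eq_square card_length mult_mono)
  also note assms(3)
  finally have "card R \<le> 2 ^ k" .
  moreover have "(u, v) \<in> R\<^sup>* \<longleftrightarrow> (\<exists>m\<le>card R. (u, v) \<in> R ^^ m)"
    using rtrancl_imp_UN_relpow[of "(u, v)" R] relpow_finite_bounded[OF fin]
    by (auto intro: relpow_imp_rtrancl)
  ultimately have "(u, v) \<in> R\<^sup>* \<longleftrightarrow> (\<exists>m\<le>2 ^ k. (u, v) \<in> R ^^ m)"
    by (meson order_trans relpow_imp_rtrancl)
  then show ?thesis using val_reach[OF assms(1,2,4,5)] by blast
qed

section \<open>Depth and length of the formula\<close>

lemma height_reach: "(\<And>u v. height (leaf u v) = 0) \<Longrightarrow> height (reach cs leaf k u v) \<le> 2 * k"
proof (induction k arbitrary: u v)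
  case (Suc k)
  \<comment> \<open>Each level of the recursion adds one conjunction and one disjunction, hence the
    factor 2.\<close>
  have "height (Conn False [reach cs leaf k u w, reach cs leaf k w v]) < 2 * Suc k" for w
    using Suc.IH[OF Suc.prems] by (simp add: le_imp_less_Suc)
  then show ?case
    unfolding reach.simps by (intro height_Conn_leI) auto
qed simp

lemma leaves_within_reach:
  "(\<And>u v. u \<in> set cs \<Longrightarrow> v \<in> set cs \<Longrightarrow> leaves_within n (leaf u v)) \<Longrightarrow>
     u \<in> set cs \<Longrightarrow> v \<in> set cs \<Longrightarrow> leaves_within n (reach cs leaf k u v)"
  by (induction k arbitrary: u v) (auto simp: list_all_iff)

text \<open>The 3 counts \<open>Open\<close>, \<open>Test\<close> and \<open>Close\<close>; the 1
  counts the \<open>Break\<close> after each subformula.\<close>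

lemma length_compile_Conn_le:
  assumes "\<And>f. f \<in> set fs \<Longrightarrow> length (compile f) \<le> l"
  shows "length (compile (Conn b fs)) \<le> 3 + length fs * (l + 1)"
proof -
  have "length (concat (map (\<lambda>ts. ts @ [Break b]) (map compile fs))) \<le> length fs * (l + 1)"
    using assms
  proof (induction fs)
    case (Cons f fs)
    then have "length (compile f) \<le> l" by simp
    with Cons show ?case by fastforce
  qed simp
  then show ?thesis by simp
qed

lemma length_compile_reach:
  assumes "\<And>u v. u \<in> set cs \<Longrightarrow> v \<in> set cs \<Longrightarrow> length (compile (leaf u v)) \<le> l" "0 < l"
  shows "u \<in> set cs \<Longrightarrow> v \<in> set cs \<Longrightarrow>
           length (compile (reach cs leaf k u v)) \<le> (16 * length cs) ^ k * l"
proof (induction k arbitrary: u v)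
  case (Suc k)
  let ?N = "length cs" and ?B = "(16 * length cs) ^ k * l"
  have N: "1 \<le> ?N" using Suc.prems(1) by (cases cs) auto
  then have B: "1 \<le> ?B" using assms(2) by simp
  have NB: "?N \<le> ?N * ?B" "1 \<le> ?N * ?B"
    using N B mult_le_mono[OF order_refl B, of ?N] mult_le_mono[OF N B] by simp_all
  have "length (compile (Conn False [reach cs leaf k u w, reach cs leaf k w v])) \<le>
      3 + 2 * (?B + 1)" if "w \<in> set cs" for w
    by (rule order_trans[OF length_compile_Conn_le[where l = ?B]])
      (use that Suc in auto)
  then have "length (compile (reach cs leaf (Suc k) u v)) \<le> 3 + ?N * (3 + 2 * (?B + 1) + 1)"
    unfolding reach.simps
    by (intro order_trans[OF length_compile_Conn_le[where l = "3 + 2 * (?B + 1)"]]) auto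
  also have "\<dots> = 3 + 6 * ?N + 2 * (?N * ?B)"
    by (simp add: algebra_simps)
  \<comment> \<open>The sum is at most 11 times \<open>?N * ?B\<close>; 16 is a power of two, which
    lets the final size bound be one as well.\<close>
  also have "\<dots> \<le> 16 * (?N * ?B)"
    using NB by linarith
  also have "\<dots> = (16 * ?N) ^ Suc k * l" by simp
  finally show ?case .
qed (use assms in simp)

section \<open>Configuration graphs\<close>

text \<open>The \<open>+ 2\<close> accounts for the end markers. Fixing the tape to be blank from
  cell \<open>b\<close> on makes the set finite.\<close>

definition configs :: "machine \<Rightarrow> nat \<Rightarrow> nat \<Rightarrow> nat \<Rightarrow> config set" where
  "configs M n l b =
     {c. state c < num_states M \<and> input_pos c < n + 2 \<and> advice_pos c < l + 2 \<and> work_pos c < b \<and>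
         (\<forall>i<b. work_tape c i < num_symbols M) \<and> (\<forall>i\<ge>b. work_tape c i = 0)}"

lemma configs_bound:
  "finite (configs M n l b)"
  "card (configs M n l b) \<le>
     num_states M * (n + 2) * (l + 2) * b * num_symbols M ^ b"
proof -
  let ?T = "{xs. set xs \<subseteq> {..<num_symbols M} \<and> length xs = b}"
  let ?P = "{..<num_states M} \<times> {..<n + 2} \<times> {..<l + 2} \<times> {..<b} \<times> ?T"
  let ?f = "\<lambda>(q, i, p, h, xs). \<lparr>state = q, input_pos = i, advice_pos = p,
              work_tape = (\<lambda>i. if i < b then xs ! i else 0), work_pos = h\<rparr>"
  have sub: "configs M n l b \<subseteq> ?f ` ?P"
  proof
    fix c assume c: "c \<in> configs M n l b"
    let ?t = "(state c, input_pos c, advice_pos c, work_pos c, map (work_tape c) [0..<b])"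
    have "c = ?f ?t"
      using c by (cases c) (auto simp: configs_def fun_eq_iff)
    moreover have "?t \<in> ?P"
      using c by (auto simp: configs_def)
    ultimately show "c \<in> ?f ` ?P" by (rule image_eqI)
  qed
  have fin: "finite ?P"
    by (simp add: finite_lists_length_eq)
  show "finite (configs M n l b)"
    using fin by (intro finite_subset[OF sub]) simp
  have "card (configs M n l b) \<le> card (?f ` ?P)"
    using fin by (intro card_mono[OF _ sub]) simp
  also have "\<dots> \<le> card ?P"
    using fin by (rule card_image_le)
  also have "\<dots> = num_states M * (n + 2) * (l + 2) * b * num_symbols M ^ b"
    by (simp only: card_cartesian_product card_lists_length_eq[OF finite_lessThan] card_lessThan
        mult_ac)
  finally show "card (configs M n l b) \<le>
     num_states M * (n + 2) * (l + 2) * b * num_symbols M ^ b" .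
qed

text \<open>A cell changes only while the work head scans it, so cells from \<open>b\<close> on stay
  blank.\<close>

lemma reachable_in_configs:
  assumes "nondeterministic_TM M" "uses_space_at_most M x y b" "reachable M x y c"
  shows "c \<in> configs M (length x) (length y) b"
  using assms(3) unfolding reachable_def
proof (induction rule: rtranclp_induct)
  case base
  have "work_pos (initial M) < b"
    using assms(2) by (auto simp: uses_space_at_most_def reachable_def)
  then show ?case
    using assms(1) by (auto simp: configs_def initial_def nondeterministic_TM_def)
next
  case (step c d)
  have d: "work_pos d < b"
    using step assms(2)
    by (auto simp: uses_space_at_most_def reachable_def intro: rtranclp.rtrancl_into_rtrancl)
  have c: "state c < num_states M" "work_tape c (work_pos c) < num_symbols M" "work_pos c < b"
    using step.IH by (auto simp: configs_def)
  from step(2) show ?case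
  proof cases
    case (1 q s d1 d2 d3)
    have "q < num_states M" "s < num_symbols M"
      using 1(4) c assms(1) unfolding nondeterministic_TM_def by blast+
    then show ?thesis
      using step.IH d c unfolding 1(1) by (auto simp: configs_def move_within_def)
  qed
qed

text \<open>A transition sees only one input cell, and the length of \<open>x\<close> through
  clamping. This is why a leaf can decide it by testing a single cell.\<close>

lemma step_cong:
  "length x = length x' \<Longrightarrow> read_cell x (input_pos c) = read_cell x' (input_pos c) \<Longrightarrow>
     step M x y c d \<longleftrightarrow> step M x' y c d"
  by (simp add: step.simps move_within_def)

lemma accepts_iff_rtrancl:
  assumes "nondeterministic_TM M" "uses_space_at_most M x y b"
  defines "C \<equiv> configs M (length x) (length y) b"
  shows "accepts M x y \<longleftrightarrow>
    (\<exists>c\<in>C. state c = accept_state M \<and>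
      (initial M, c) \<in> {(u, v). u \<in> C \<and> v \<in> C \<and> step M x y u v}\<^sup>*)"
    (is "_ \<longleftrightarrow> (\<exists>c\<in>C. _ \<and> _ \<in> ?R\<^sup>*)")
proof -
  have "(initial M, c) \<in> ?R\<^sup>* \<and> c \<in> C" if "reachable M x y c" for c
    using that unfolding reachable_def
  proof (induction rule: rtranclp_induct)
    case base
    show ?case
      using reachable_in_configs[OF assms(1,2), of "initial M"]
      by (simp add: C_def reachable_def)
  next
    case (step c d)
    then have "reachable M x y d" by (auto simp: reachable_def)
    then have "d \<in> C"
      unfolding C_def by (rule reachable_in_configs[OF assms(1,2)])
    with step show ?case by (auto intro: rtrancl_into_rtrancl)
  qed
  moreover have "reachable M x y c" if "(initial M, c) \<in> ?R\<^sup>*" for c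
    using that unfolding reachable_def
    by (induction rule: rtrancl_induct) (auto intro: rtranclp.rtrancl_into_rtrancl)
  ultimately show ?thesis
    unfolding accepts_def by blast
qed

text \<open>The advice \<open>y\<close> is hardwired into one formula serving all inputs of length
  \<open>n\<close>. It asks whether some accepting configuration is reachable; at most
  \<open>2 ^ j\<close> configurations give recursion depth \<open>2 * j\<close>.\<close>

lemma acceptance_formula:
  assumes M: "nondeterministic_TM M"
    and space: "\<And>x. length x = n \<Longrightarrow> uses_space_at_most M x y b"
    and j: "num_states M * (n + 2) * (length y + 2) * b * num_symbols M ^ b \<le> 2 ^ j"
  shows "\<exists>f. leaves_within (Suc n) f \<and> height f \<le> 4 * j + 1 \<and>
           length (compile f) \<le> 5 * (2 * n + 3) * 2 ^ (2 * j\<^sup>2 + 9 * j) \<and>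
           (\<forall>x. length x = n \<longrightarrow> (val x f \<longleftrightarrow> accepts M x y))"
proof -
  let ?C = "configs M n (length y) b"
  obtain cs where cs: "set cs = ?C" "distinct cs"
    using finite_distinct_list[OF configs_bound(1)] by blast
  have len: "length cs \<le> 2 ^ j"
    using configs_bound(2)[of M n "length y" b] j cs by (simp flip: distinct_card)
  then have len2: "(length cs)\<^sup>2 \<le> 2 ^ (2 * j)"
    by (metis power_mono power_mult mult.commute zero_le)
  \<comment> \<open>The initial configuration does not depend on the input, so any word of length
    \<open>n\<close> will do.\<close>
  have init: "initial M \<in> set cs"
    using reachable_in_configs[OF M space[of "replicate n True"], of "initial M"] cs
    by (simp add: reachable_def)
  \<comment> \<open>The set collects the cell contents that permit the step; by
    \<open>step_cong\<close> the choice of the witness \<open>x\<close> is immaterial. The case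
    \<open>u = v\<close> supplies the reflexivity that Savitch's recursion needs.\<close>
  define leaf where "leaf = (\<lambda>u v. Leaf (input_pos u)
    {a. u = v \<or> (\<exists>x. length x = n \<and> read_cell x (input_pos u) = a \<and> step M x y u v)})"
  define accs where "accs = filter (\<lambda>c. state c = accept_state M) cs"
  define f where "f = Conn True (map (reach cs leaf (2 * j) (initial M)) accs)"
  have accs: "set accs \<subseteq> set cs" "length accs \<le> length cs"
    by (auto simp: accs_def)
  have "leaves_within (Suc n) f"
    using init accs cs leaves_within_reach[of cs "Suc n" leaf]
    by (auto simp: f_def list_all_iff leaf_def configs_def)
  moreover have "height f \<le> 4 * j + 1"
    unfolding f_def
  proof (rule height_Conn_leI)
    fix g assume "g \<in> set (map (reach cs leaf (2 * j) (initial M)) accs)"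
    then obtain c where g: "g = reach cs leaf (2 * j) (initial M) c" by auto
    show "height g < 4 * j + 1"
      unfolding g using height_reach[of leaf cs "2 * j" "initial M" c] by (simp add: leaf_def)
  qed simp
  moreover have "length (compile f) \<le> 5 * (2 * n + 3) * 2 ^ (2 * j\<^sup>2 + 9 * j)"
  proof -
    \<comment> \<open>A leaf takes at most \<open>2 * n + 3\<close> tokens: \<open>n + 1\<close>
      moves each way and one test.\<close>
    let ?B = "(16 * length cs) ^ (2 * j) * (2 * n + 3)" and ?N = "length cs"
    have N: "1 \<le> ?N" using init by (cases cs) auto
    have B: "1 \<le> ?B" using N by (simp add: Suc_le_eq)
    have NB: "?N \<le> ?N * ?B" "1 \<le> ?N * ?B"
      using mult_le_mono[OF order_refl B, of ?N] mult_le_mono[OF N B] by simp_all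
    have "length (compile (reach cs leaf (2 * j) (initial M) c)) \<le> ?B" if "c \<in> set cs" for c
      using init that cs by (intro length_compile_reach) (auto simp: leaf_def configs_def)
    then have "length (compile f) \<le> 3 + length accs * (?B + 1)"
      unfolding f_def using accs
      by (intro order_trans[OF length_compile_Conn_le[where l = ?B]]) auto
    also have "\<dots> \<le> 3 + ?N * (?B + 1)"
      using mult_le_mono1[OF accs(2), of "?B + 1"] by simp
    also have "\<dots> = 3 + ?N + ?N * ?B" by (simp add: algebra_simps)
    also have "\<dots> \<le> 5 * (?N * ?B)" using NB by linarith
    also have "\<dots> = 5 * (2 * n + 3) * (?N * (16 * ?N) ^ (2 * j))" by (simp only: mult_ac)
    also have "\<dots> \<le> 5 * (2 * n + 3) * (2 ^ j * (16 * 2 ^ j) ^ (2 * j))"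
      using len by (intro mult_le_mono power_mono) auto
    also have "(2::nat) ^ j * (16 * 2 ^ j) ^ (2 * j) = 2 ^ j * ((2 ^ (4 + j)) ^ (2 * j))"
      by (simp add: power_add)
    \<comment> \<open>The exponent is \<open>j + 2 * j * (4 + j)\<close>.\<close>
    also have "\<dots> = 2 ^ (2 * j\<^sup>2 + 9 * j)"
      by (simp add: power2_eq_square algebra_simps flip: power_mult power_add)
    finally show ?thesis .
  qed
  moreover have "val x f \<longleftrightarrow> accepts M x y" if x: "length x = n" for x
  proof -
    let ?R = "{(u, v). u \<in> ?C \<and> v \<in> ?C \<and> step M x y u v}"
    have leaf: "val x (leaf u v) \<longleftrightarrow> u = v \<or> (u, v) \<in> ?R" if "u \<in> set cs" "v \<in> set cs" for u v
    proof -
      have "(\<exists>x'. length x' = n \<and> read_cell x' (input_pos u) = read_cell x (input_pos u) \<and>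
              step M x' y u v) \<longleftrightarrow> step M x y u v"
        using x step_cong[of _ x u M y v] by metis
      then show ?thesis using that cs by (simp add: leaf_def)
    qed
    have "val x (reach cs leaf (2 * j) (initial M) c) \<longleftrightarrow> (initial M, c) \<in> ?R\<^sup>*"
      if "c \<in> set cs" for c
      using init that cs len2 by (intro val_reach_rtrancl leaf) auto
    then have "val x f \<longleftrightarrow> (\<exists>c\<in>?C. state c = accept_state M \<and> (initial M, c) \<in> ?R\<^sup>*)"
      using cs by (auto simp: f_def accs_def)
    also have "\<dots> \<longleftrightarrow> accepts M x y"
      using accepts_iff_rtrancl[OF M space[OF x]] x by simp
    finally show ?thesis .
  qed
  ultimately show ?thesis by blast
qed

section \<open>Asymptotics\<close>

text \<open>Polynomial advice has logarithmically many bits in the index of a head position. The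
  \<open>+ 2\<close> accounts for the end markers and keeps the logarithm positive.\<close>

lemma ln_polynomial_size_bigo:
  assumes "f \<in> polynomial_size"
  shows "(\<lambda>n. ln (real (f n) + 2)) \<in> O(\<lambda>n. ln (real n))"
proof -
  from assms obtain k where "(\<lambda>n. real (f n)) \<in> O(\<lambda>n. real n ^ k)"
    by (auto simp: polynomial_size_def)
  then obtain c where c: "c > 0" "\<forall>\<^sub>F n in sequentially. real (f n) \<le> c * real n ^ k"
    by (auto elim!: landau_o.bigE)
  have "\<forall>\<^sub>F n in sequentially. norm (ln (real (f n) + 2)) \<le> norm (ln (c + 2) + real k * ln (real n))"
    using c(2) eventually_gt_at_top[of 0]
  proof eventually_elim
    case (elim n)
    then have "1 \<le> real n ^ k" by simp
    with elim(1) have "real (f n) + 2 \<le> c * real n ^ k + 2 * real n ^ k"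
      by linarith
    then have "real (f n) + 2 \<le> (c + 2) * real n ^ k"
      by (simp only: distrib_right)
    then have "ln (real (f n) + 2) \<le> ln ((c + 2) * real n ^ k)"
      using c(1) elim(2) by (subst ln_le_cancel_iff) auto
    also have "\<dots> = ln (c + 2) + real k * ln (real n)"
      using c elim by (simp add: ln_mult ln_realpow)
    finally show ?case by simp
  qed
  then have "(\<lambda>n. ln (real (f n) + 2)) \<in> O(\<lambda>n. ln (c + 2) + real k * ln (real n))"
    by (rule landau_o.big_mono)
  also have "(\<lambda>n. ln (c + 2) + real k * ln (real n)) \<in> O(\<lambda>n. ln (real n))"
    by (intro sum_in_bigo) (simp_all, real_asymp)
  finally show ?thesis .
qed

text \<open>The factor \<open>d (2 n + 3)\<close> is there to absorb the other factors of the program length.\<close>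

lemma logarithmic_exponent:
  fixes b l :: "nat \<Rightarrow> nat" and d s g :: nat
  assumes b: "(\<lambda>n. real (b n)) \<in> O(\<lambda>n. ln (real n))" and l: "l \<in> polynomial_size"
    and pos: "0 < d" "0 < s" "0 < g"
  obtains j :: "nat \<Rightarrow> nat" where "(\<lambda>n. real (j n)) \<in> O(\<lambda>n. ln (real n))"
    and "\<And>n. s * (n + 2) * (l n + 2) * b n * g ^ b n \<le> 2 ^ j n"
    and "\<And>n. d * (2 * n + 3) \<le> 2 ^ j n"
proof
  \<comment> \<open>One product dominates both required quantities. Using \<open>b n + 1\<close> for
    \<open>b n\<close> makes it positive, so that its logarithm is nonnegative.\<close>
  define X where
    "X n = (d * (2 * n + 3)) * (s * (n + 2) * (l n + 2) * (b n + 1) * g ^ b n)" for n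
  define j where "j n = nat \<lceil>log 2 (real (X n))\<rceil>" for n
  have X: "1 \<le> X n" for n
    using pos by (simp add: X_def Suc_le_eq)
  have "real (X n) \<le> 2 ^ j n" for n
  proof -
    have "log 2 (real (X n)) \<le> real (j n)"
      unfolding j_def by linarith
    then show ?thesis
      using X[of n] by (simp add: log_le_iff powr_realpow)
  qed
  then have Xj: "X n \<le> 2 ^ j n" for n
    by (metis of_nat_le_iff of_nat_numeral of_nat_power)
  have "1 \<le> d * (2 * n + 3)" "1 \<le> s * (n + 2) * (l n + 2) * (b n + 1) * g ^ b n" for n
    using pos by (simp_all add: Suc_le_eq)
  then have "s * (n + 2) * (l n + 2) * (b n + 1) * g ^ b n \<le> X n" "d * (2 * n + 3) \<le> X n" for n
    unfolding X_def by (metis mult_le_mono mult_1 mult_1_right order_refl)+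
  then show "d * (2 * n + 3) \<le> 2 ^ j n"
    "s * (n + 2) * (l n + 2) * b n * g ^ b n \<le> 2 ^ j n" for n
    using Xj[of n] by (meson order_trans mult_le_mono le_add1 order_refl)+
  \<comment> \<open>Every summand is logarithmic in \<open>n\<close>; the power
    \<open>g ^ b n\<close> contributes a constant multiple of \<open>b n\<close>.\<close>
  have "ln (real (X n)) = ln (real d) + ln (2 * real n + 3) + (ln (real s) + ln (real n + 2) +
      ln (real (l n) + 2) + ln (real (b n) + 1) + real (b n) * ln (real g))" for n
  proof -
    have "real (X n) = real d * (2 * real n + 3) * (real s * (real n + 2) * (real (l n) + 2) *
        (real (b n) + 1) * real g ^ b n)"
      by (simp add: X_def algebra_simps)
    then show ?thesis
      using pos by (simp add: ln_mult ln_realpow)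
  qed
  moreover have "(\<lambda>n. ln (real d) + ln (2 * real n + 3) + (ln (real s) + ln (real n + 2) +
      ln (real (l n) + 2) + ln (real (b n) + 1) + real (b n) * ln (real g)))
      \<in> O(\<lambda>n. ln (real n))"
  proof (intro sum_in_bigo)
    have "(\<lambda>n. ln (real (b n) + 1)) \<in> O(\<lambda>n. real (b n))"
      by (intro landau_o.big_mono always_eventually allI)
        (simp add: ln_add_one_self_le_self add.commute[of _ 1])
    also note b
    finally show "(\<lambda>n. ln (real (b n) + 1)) \<in> O(\<lambda>n. ln (real n))" .
    show "(\<lambda>n. ln (real (l n) + 2)) \<in> O(\<lambda>n. ln (real n))"
      using l by (rule ln_polynomial_size_bigo)
    show "(\<lambda>n. real (b n) * ln (real g)) \<in> O(\<lambda>n. ln (real n))"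
      using landau_o.big.mult[OF b, of "\<lambda>_. ln (real g)" "\<lambda>_. 1"] by simp
  qed real_asymp+
  ultimately have lnX: "(\<lambda>n. ln (real (X n))) \<in> O(\<lambda>n. ln (real n))"
    by simp
  have "norm (real (j n)) \<le> norm (ln (real (X n)) / ln 2 + 1)" for n
  proof -
    have "0 \<le> ln (real (X n)) / ln 2"
      using X[of n] by simp
    then show ?thesis
      unfolding j_def log_def real_norm_def by linarith
  qed
  then have "(\<lambda>n. real (j n)) \<in> O(\<lambda>n. ln (real (X n)) / ln 2 + 1)"
    by (intro landau_o.big_mono always_eventually allI)
  also have "(\<lambda>n. ln (real (X n)) / ln 2 + 1) \<in> O(\<lambda>n. ln (real n))"
    using lnX by (intro sum_in_bigo) (simp, real_asymp)
  finally show "(\<lambda>n. real (j n)) \<in> O(\<lambda>n. ln (real n))" .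
qed

text \<open>The exponent is quadratic in \<open>ln n\<close>, so the cube of \<open>log 2 n\<close>
  eventually exceeds it whatever the constant in the bound on \<open>j\<close>.\<close>

lemma quasipolynomial_sizeI:
  assumes j: "(\<lambda>n. real (j n)) \<in> O(\<lambda>n. ln (real n))"
    and le: "\<And>n. f n \<le> 2 ^ (2 * (j n)\<^sup>2 + 10 * j n)"
  shows "f \<in> quasipolynomial_size"
proof -
  from j obtain c where c: "c > 0" "\<forall>\<^sub>F n in sequentially. real (j n) \<le> c * norm (ln (real n))"
    by (auto elim!: landau_o.bigE)
  have "\<forall>\<^sub>F n in sequentially. 2 * (c * ln (real n))\<^sup>2 + 10 * (c * ln (real n)) \<le> log 2 (real n) ^ 3"
    using c(1) by real_asymp
  with c(2) eventually_gt_at_top[of 0]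
  have "\<forall>\<^sub>F n in sequentially. real (f n) \<le> 2 powr (log 2 (real n) ^ 3)"
  proof eventually_elim
    case (elim n)
    have jn: "real (j n) \<le> c * ln (real n)"
      using elim by simp
    have "real (f n) \<le> real (2 ^ (2 * (j n)\<^sup>2 + 10 * j n))"
      using le of_nat_le_iff by blast
    also have "\<dots> = 2 powr (2 * (real (j n))\<^sup>2 + 10 * real (j n))"
      by (simp flip: powr_realpow)
    also have "2 * (real (j n))\<^sup>2 + 10 * real (j n) \<le>
        2 * (c * ln (real n))\<^sup>2 + 10 * (c * ln (real n))"
      using jn by (intro add_mono mult_left_mono power_mono) auto
    also note elim(3)
    finally show ?case by simp
  qed
  then show ?thesis
    unfolding quasipolynomial_size_def by blast
qed

section \<open>From a nondeterministic machine to advice for the interpreter\<close>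

theorem theorem4: "L_quasipoly \<supseteq> NL_poly"
proof
  fix A assume "A \<in> NL_poly"
  then obtain M a b where M: "nondeterministic_TM M"
    and a: "(\<lambda>n. length (a n)) \<in> polynomial_size"
    and b: "(\<lambda>n. real (b n)) \<in> O(\<lambda>n. ln (real n))"
    and space: "\<And>x. uses_space_at_most M x (a (length x)) (b (length x))"
    and A: "\<And>x. x \<in> A \<longleftrightarrow> accepts M x (a (length x))"
    unfolding NL_poly_def NL_with_advice_def logspace_with_advice_def by blast
  have "0 < num_states M" "0 < num_symbols M" "0 < 5 * token_count"
    using M token_no_less[of Open] by (auto simp: nondeterministic_TM_def)
  from logarithmic_exponent[OF b a this(3,1,2)] obtain j where
    j: "(\<lambda>n. real (j n)) \<in> O(\<lambda>n. ln (real n))"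
    and confs:
      "\<And>n. num_states M * (n + 2) * (length (a n) + 2) * b n * num_symbols M ^ b n \<le> 2 ^ j n"
    and tokens: "\<And>n. 5 * token_count * (2 * n + 3) \<le> 2 ^ j n" by blast
  \<comment> \<open>One formula is chosen for each length; the choice need not be computable, since
    the formula goes into the advice.\<close>
  have "\<forall>n. \<exists>f. leaves_within (Suc n) f \<and> height f \<le> 4 * j n + 1 \<and>
           length (compile f) \<le> 5 * (2 * n + 3) * 2 ^ (2 * (j n)\<^sup>2 + 9 * j n) \<and>
           (\<forall>x. length x = n \<longrightarrow> (val x f \<longleftrightarrow> accepts M x (a n)))"
    by (intro allI acceptance_formula[OF M _ confs]) (use space in blast)
  then obtain f where leaves: "\<And>n. leaves_within (Suc n) (f n)"
    and height: "\<And>n. height (f n) \<le> 4 * j n + 1"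
    and length: "\<And>n. length (compile (f n)) \<le> 5 * (2 * n + 3) * 2 ^ (2 * (j n)\<^sup>2 + 9 * j n)"
    and val: "\<And>x. val x (f (length x)) \<longleftrightarrow> accepts M x (a (length x))"
    by metis
  define a' where "a' n = concat (map token_code (compile (f n)))" for n
  note interpreter = interpreter_correct[OF leaves a'_def]
  have "length (a' n) \<le> 2 ^ (2 * (j n)\<^sup>2 + 10 * j n)" for n
  proof -
    have "length (a' n) \<le> token_count * (5 * (2 * n + 3) * 2 ^ (2 * (j n)\<^sup>2 + 9 * j n))"
      unfolding a'_def
      using length_concat_token_code mult_le_mono2[OF length] by (rule order_trans)
    also have "\<dots> = 5 * token_count * (2 * n + 3) * 2 ^ (2 * (j n)\<^sup>2 + 9 * j n)"
      by (simp only: mult_ac)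
    \<comment> \<open>The constants and the leaf length were built into the choice of
      \<open>j\<close>, raising \<open>9 * j n\<close> to \<open>10 * j n\<close>.\<close>
    also have "\<dots> \<le> 2 ^ j n * 2 ^ (2 * (j n)\<^sup>2 + 9 * j n)"
      using tokens by (rule mult_le_mono1)
    also have "\<dots> = 2 ^ (2 * (j n)\<^sup>2 + 10 * j n)"
      by (simp flip: power_add)
    finally show ?thesis .
  qed
  then have "(\<lambda>n. length (a' n)) \<in> quasipolynomial_size"
    by (rule quasipolynomial_sizeI[OF j])
  moreover have "logspace_with_advice interpreter a'"
    unfolding logspace_with_advice_def
  proof (intro exI conjI allI)
    \<comment> \<open>The new space bound is the bracket depth plus one, linear in
      \<open>j n\<close> and so logarithmic, however long the advice is.\<close>
    show "(\<lambda>n. real (Suc (height (f n)))) \<in> O(\<lambda>n. ln (real n))"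
    proof -
      have "(\<lambda>n. real (Suc (height (f n)))) \<in> O(\<lambda>n. 4 * real (j n) + 2)"
      proof (intro landau_o.big_mono always_eventually allI)
        have "real (Suc (height (f n))) \<le> real (4 * j n + 2)" for n
          using height[of n] by (subst of_nat_le_iff) simp
        then show "norm (real (Suc (height (f n)))) \<le> norm (4 * real (j n) + 2)" for n
          by simp
      qed
      also have "(\<lambda>n. 4 * real (j n) + 2) \<in> O(\<lambda>n. ln (real n))"
        using j by (intro sum_in_bigo) (simp, real_asymp)
      finally show ?thesis .
    qed
    show "uses_space_at_most interpreter x (a' (length x)) (Suc (height (f (length x))))" for x
      by (rule interpreter(3))
  qed
  moreover have "x \<in> A \<longrightarrow> accepts interpreter x (a' (length x))"
    "x \<notin> A \<longrightarrow> rejects interpreter x (a' (length x))" for x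
    using interpreter(1,2) val A by blast+
  ultimately show "A \<in> L_quasipoly"
    unfolding L_quasipoly_def L_with_advice_def using deterministic_interpreter by blast
qed

end
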